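(* Drop $k$ balls independently and uniformly into $n$ boxes. If $k = n \log n + \theta n$, and $W$ denotes the number of empty boxes, then $$\|\mathcal{L}(W) - \mathrm{Poi}_{e^{-\theta}}\|_{TV} \leq O\left(\frac{e^{-\theta}}{\sqrt{\log n}}\right).$$
   Context: Each ball is equally likely to fall into any of the $n$ boxes, and $\theta$ is the number defined by writing $k = n\log n + \theta n$, with $\log$ the natural logarithm. $\mathcal{L}(W)$ denotes the law of $W$ and $\mathrm{Poi}_\lambda$ the Poisson distribution with parameter (mean) $\lambda$ on $\{0,1,2,\ldots\}$. The total variation distance is $\|\mu-\nu\|_{TV} = \sup_A |\mu(A)-\nu(A)|$, the supremum being over all measurable sets $A$.
   Formalization: The O-constant is uniform over n ≥ 2 and all k with θ ≤ A n/√(log n), for any fixed A (constant depends only on A); without an upper bound on θ the claim fails, e.g. k = n³, where the distance is asymptotic to e^{-θ}. *)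

theory Defs
  imports "HOL-Probability.Probability"
begin

definition tv_dist :: "'a measure \<Rightarrow> 'a measure \<Rightarrow> real" where
  "tv_dist M N = (SUP A\<in>sets M. \<bar>measure M A - measure N A\<bar>)"

(* f i is the box receiving ball i; the default value 0 outside {..<k} is irrelevant. *)
definition ball_drops :: "nat \<Rightarrow> nat \<Rightarrow> (nat \<Rightarrow> nat) pmf" where
  "ball_drops k n = Pi_pmf {..<k} 0 (\<lambda>_. pmf_of_set {..<n})"

definition num_empty_boxes :: "nat \<Rightarrow> nat \<Rightarrow> (nat \<Rightarrow> nat) \<Rightarrow> nat" where
  "num_empty_boxes k n f = card {j. j < n \<and> (\<forall>i<k. f i \<noteq> j)}"

definition empty_boxes_law :: "nat \<Rightarrow> nat \<Rightarrow> nat pmf" where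
  "empty_boxes_law k n = map_pmf (num_empty_boxes k n) (ball_drops k n)"

end

theory Submission
  imports Defs
begin

text \<open>
  The binomial moments of the number \<open>W\<close> of empty boxes are explicit:
  \<open>E (W choose s) = (n choose s) (1 - s/n)^k\<close>, while those of the Poisson law with mean
  \<open>\<lambda> = exp (-\<theta>) = n exp (-k/n)\<close> are \<open>\<lambda>^s / s!\<close>. The former never exceed the latter, and the
  relative error is at most \<open>s\<^sup>2 (1/n + k/n\<^sup>2)\<close>. Inclusion-exclusion recovers both laws from
  their binomial moments, so the total variation distance is at most the sum over \<open>s\<close> of
  \<open>2^s\<close> times the moment differences, which is \<open>O(\<lambda> exp (4\<lambda>) (1/n + k/n\<^sup>2))\<close>. This crude bound
  suffices: one may assume \<open>\<lambda> \<le> sqrt (ln n)\<close>, as otherwise the claim only says that the distance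
  is \<open>O(1)\<close>, and \<open>exp (4 sqrt (ln n))\<close> is negligible against \<open>n\<close>.
\<close>

section \<open>Inclusion-exclusion from binomial moments\<close>

text \<open>Since \<open>(W choose s) * (s choose j) = (W choose j) * ((W - j) choose (s -
  j))\<close>, what remains is an alternating row sum, which vanishes unless \<open>W = j\<close>.
  The range goes up to a common bound \<open>N\<close> rather than \<open>W\<close>, so that
  expectations can be taken termwise when \<open>W\<close> is random. The truncated
  \<open>s - j\<close> is harmless, as \<open>s choose j\<close> is zero for
  \<open>s < j\<close>.\<close>

lemma binomial_inversion_point:
  fixes W j N :: nat
  assumes "W \<le> N"
  shows "(\<Sum>s\<le>N. (-1)^(s - j) * real (s choose j) * real (W choose s)) = of_bool (W = j)"
proof (cases "j \<le> W")
  case False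
  have "(-1)^(s - j) * real (s choose j) * real (W choose s) = 0" for s
    using False by (cases "s < j") (auto simp: binomial_eq_0)
  then have "(\<Sum>s\<le>N. (-1)^(s - j) * real (s choose j) * real (W choose s)) = 0"
    by (intro sum.neutral) blast
  then show ?thesis
    using False by simp
next
  case True
  have "(\<Sum>s\<le>N. (-1)^(s - j) * real (s choose j) * real (W choose s))
      = (\<Sum>s=j..W. (-1)^(s - j) * real (s choose j) * real (W choose s))"
    using assms by (intro sum.mono_neutral_right) (auto simp: binomial_eq_0 not_le)
  also have "\<dots> = (\<Sum>r\<le>W - j. (-1)^r * real (W choose j) * real ((W - j) choose r))"
  proof (rule sum.reindex_bij_witness[of _ "\<lambda>r. r + j" "\<lambda>s. s - j"])
    fix s assume s: "s \<in> {j..W}"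
    then have "(W choose s) * (s choose j) = (W choose j) * ((W - j) choose (s - j))"
      by (intro choose_mult) auto
    then have "real (W choose s) * real (s choose j) = real (W choose j) * real ((W - j) choose (s - j))"
      by (metis of_nat_mult)
    then show "(-1)^(s - j) * real (W choose j) * real ((W - j) choose (s - j))
        = (-1)^(s - j) * real (s choose j) * real (W choose s)"
      by (simp add: mult_ac)
  qed (use True in auto)
  also have "\<dots> = real (W choose j) * (\<Sum>r\<le>W - j. (-1)^r * real ((W - j) choose r))"
    by (simp add: sum_distrib_left mult_ac)
  also have "\<dots> = of_bool (W = j)"
    using True choose_alternating_sum[of "W - j", where 'a = real] by (cases "W = j") auto
  finally show ?thesis .
qed

section \<open>Binomial moments of the number of empty boxes\<close>

lemma finite_set_pmf_ball_drops: "n > 0 \<Longrightarrow> finite (set_pmf (ball_drops k n))"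
  unfolding ball_drops_def
  by (subst set_Pi_pmf) (auto intro!: finite_PiE_dflt simp: set_pmf_of_set lessThan_empty_iff)

lemma num_empty_boxes_le: "num_empty_boxes k n f \<le> n"
proof -
  have "num_empty_boxes k n f \<le> card {..<n}"
    unfolding num_empty_boxes_def by (intro card_mono) auto
  then show ?thesis by simp
qed

text \<open>The event is a product event: independently, each ball avoids \<open>T\<close> with
  probability \<open>1 - card T / n\<close>.\<close>

lemma prob_boxes_empty:
  assumes "n > 0" "T \<subseteq> {..<n}"
  shows "measure_pmf.prob (ball_drops k n) {f. \<forall>i<k. f i \<notin> T} = (1 - card T / n) ^ k"
proof -
  have "{f. \<forall>i<k. f i \<notin> T} = Pi {..<k} (\<lambda>_. - T)"
    by auto
  moreover have "{..<n} \<inter> - T = {..<n} - T" by auto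
  then have "card ({..<n} \<inter> - T) = n - card T"
    using assms by (simp add: card_Diff_subset finite_subset)
  moreover have "card T \<le> n"
    using card_mono[OF _ assms(2)] by simp
  ultimately show ?thesis
    using assms(1)
    by (simp add: ball_drops_def measure_Pi_pmf_Pi measure_pmf_of_set lessThan_empty_iff
        of_nat_diff diff_divide_distrib)
qed

text \<open>\<open>W choose s\<close> counts the \<open>s\<close>-sets of boxes that are all empty,
  so linearity of expectation applies.\<close>

lemma expectation_choose_num_empty_boxes:
  assumes "n > 0"
  shows "measure_pmf.expectation (ball_drops k n) (\<lambda>f. real (num_empty_boxes k n f choose s))
    = real (n choose s) * (1 - s / n) ^ k"
proof -
  define \<T> where "\<T> = {T. T \<subseteq> {..<n} \<and> card T = s}"
  have fin: "finite \<T>"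
    unfolding \<T>_def by (rule finite_subset[of _ "Pow {..<n}"]) auto
  have count: "real (num_empty_boxes k n f choose s)
      = (\<Sum>T\<in>\<T>. indicat_real {f. \<forall>i<k. f i \<notin> T} f)" for f
  proof -
    let ?E = "{j. j < n \<and> (\<forall>i<k. f i \<noteq> j)}"
    have "num_empty_boxes k n f choose s = card {T. T \<subseteq> ?E \<and> card T = s}"
      unfolding num_empty_boxes_def by (subst n_subsets) auto
    also have "{T. T \<subseteq> ?E \<and> card T = s} = {T \<in> \<T>. \<forall>i<k. f i \<notin> T}"
      unfolding \<T>_def by auto
    finally show ?thesis
      using fin by (simp add: indicator_def sum.If_cases Int_def)
  qed
  have "measure_pmf.expectation (ball_drops k n) (\<lambda>f. real (num_empty_boxes k n f choose s))
      = (\<Sum>T\<in>\<T>. measure_pmf.prob (ball_drops k n) {f. \<forall>i<k. f i \<notin> T})"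
    unfolding count
    by (subst Bochner_Integration.integral_sum)
       (auto intro!: integrable_measure_pmf_finite finite_set_pmf_ball_drops assms)
  also have "\<dots> = (\<Sum>T\<in>\<T>. (1 - s / n) ^ k)"
    by (intro sum.cong) (auto simp: \<T>_def prob_boxes_empty assms)
  also have "\<dots> = real (n choose s) * (1 - s / n) ^ k"
    by (simp add: \<T>_def n_subsets)
  finally show ?thesis .
qed

text \<open>This is the expectation of the pointwise inversion. The sum is finite, but it is stated
  as a series to have the same shape as its Poisson counterpart.\<close>

lemma pmf_empty_boxes_law_sums:
  assumes "n > 0"
  shows "(\<lambda>s. (-1)^(s - j) * real (s choose j) * (real (n choose s) * (1 - s / n) ^ k))
    sums pmf (empty_boxes_law k n) j"
proof -
  let ?W = "num_empty_boxes k n"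
  have "pmf (empty_boxes_law k n) j
      = measure_pmf.expectation (ball_drops k n) (\<lambda>f. of_bool (?W f = j))"
  proof -
    have "pmf (empty_boxes_law k n) j = measure_pmf.prob (ball_drops k n) (?W -` {j})"
      by (simp add: empty_boxes_law_def pmf_map)
    also have "\<dots> = measure_pmf.expectation (ball_drops k n) (indicator (?W -` {j}))"
      by simp
    also have "(indicator (?W -` {j}) :: _ \<Rightarrow> real) = (\<lambda>f. of_bool (?W f = j))"
      by (auto simp: indicator_def)
    finally show ?thesis .
  qed
  also have "\<dots> = measure_pmf.expectation (ball_drops k n)
      (\<lambda>f. \<Sum>s\<le>n. (-1)^(s - j) * real (s choose j) * real (?W f choose s))"
    by (simp add: binomial_inversion_point num_empty_boxes_le)
  also have "\<dots> = (\<Sum>s\<le>n. (-1)^(s - j) * real (s choose j) *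
      measure_pmf.expectation (ball_drops k n) (\<lambda>f. real (?W f choose s)))"
    by (subst Bochner_Integration.integral_sum)
       (auto intro!: integrable_measure_pmf_finite finite_set_pmf_ball_drops assms)
  also have "\<dots> = (\<Sum>s\<le>n. (-1)^(s - j) * real (s choose j) * (real (n choose s) * (1 - s / n) ^ k))"
    by (simp add: expectation_choose_num_empty_boxes assms)
  finally show ?thesis
    using sums_finite[of "{..n}"
        "\<lambda>s. (-1)^(s - j) * real (s choose j) * (real (n choose s) * (1 - s / n) ^ k)"]
    by (simp add: binomial_eq_0)
qed

text \<open>Terms with \<open>s < j\<close> vanish; shifting by \<open>j\<close> leaves
  \<open>l ^ j / fact j\<close> times the exponential series of \<open>- l\<close>.\<close>

lemma pmf_poisson_sums:
  fixes l :: real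
  assumes "l > 0"
  shows "(\<lambda>s. (-1)^(s - j) * real (s choose j) * (l ^ s / fact s)) sums pmf (poisson_pmf l) j"
proof -
  let ?f = "\<lambda>s. (-1)^(s - j) * real (s choose j) * (l ^ s / fact s)"
  have "(\<lambda>r. (l ^ j / fact j) * ((-l) ^ r / fact r)) sums (l ^ j / fact j * exp (- l))"
    using exp_converges[of "- l"] by (intro sums_mult) (simp add: divide_inverse mult_ac)
  also have "(\<lambda>r. (l ^ j / fact j) * ((-l) ^ r / fact r)) = (\<lambda>r. ?f (r + j))"
  proof
    fix r
    have "real ((r + j) choose j) = fact (r + j) / (fact j * fact r)"
      by (simp add: binomial_fact)
    then show "(l ^ j / fact j) * ((-l) ^ r / fact r) = ?f (r + j)"
      by (simp add: power_add power_minus[of l] field_simps)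
  qed
  finally have "?f sums (l ^ j / fact j * exp (- l) + (\<Sum>s<j. ?f s))"
    by (subst (asm) sums_iff_shift) simp
  moreover have "(\<Sum>s<j. ?f s) = 0"
    by (intro sum.neutral) (auto simp: binomial_eq_0)
  ultimately show ?thesis
    using assms by (simp add: pmf_poisson)
qed

section \<open>Total variation distance from binomial moments\<close>

lemma tv_dist_pmf_leI:
  assumes "\<And>A. \<bar>measure_pmf.prob p A - measure_pmf.prob q A\<bar> \<le> B"
  shows "tv_dist (measure_pmf p) (measure_pmf q) \<le> B"
  unfolding tv_dist_def using assms by (intro cSUP_least) auto

lemma tv_dist_pmf_le_1: "tv_dist (measure_pmf p) (measure_pmf q) \<le> 1"
proof (rule tv_dist_pmf_leI)
  show "\<bar>measure_pmf.prob p A - measure_pmf.prob q A\<bar> \<le> 1" for A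
    using measure_pmf.prob_le_1[of p A] measure_pmf.prob_le_1[of q A]
      measure_nonneg[of p A] measure_nonneg[of q A] by linarith
qed

text \<open>Summing the two inversion formulas over \<open>j\<close> in an event, the moment
  difference of order \<open>s\<close> gets total weight at most the row sum \<open>2 ^ s\<close> of
  Pascal's triangle. Finite events come first, since a finite sum commutes with the series
  freely.\<close>

lemma tv_dist_le_binomial_moments:
  fixes p q :: "nat pmf" and S L D :: "nat \<Rightarrow> real"
  assumes S: "\<And>j. (\<lambda>s. (-1)^(s - j) * real (s choose j) * S s) sums pmf p j"
    and L: "\<And>j. (\<lambda>s. (-1)^(s - j) * real (s choose j) * L s) sums pmf q j"
    and D: "\<And>s. \<bar>S s - L s\<bar> \<le> D s"
    and summ: "(\<lambda>s. 2 ^ s * D s) sums B"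
  shows "tv_dist (measure_pmf p) (measure_pmf q) \<le> B"
proof (rule tv_dist_pmf_leI)
  fix A :: "nat set"
  have row: "(\<Sum>j\<in>F. real (s choose j)) \<le> 2 ^ s" if "finite F" for F s
  proof -
    have "(\<Sum>j\<in>F. real (s choose j)) \<le> (\<Sum>j\<in>F \<union> {..s}. real (s choose j))"
      using that by (intro sum_mono2) auto
    also have "\<dots> = (\<Sum>j\<le>s. real (s choose j))"
      using that by (intro sum.mono_neutral_right) (auto simp: binomial_eq_0)
    also have "\<dots> = 2 ^ s"
      using choose_row_sum[of s] by (metis of_nat_sum of_nat_numeral of_nat_power)
    finally show ?thesis .
  qed
  have fin: "\<bar>measure_pmf.prob p F - measure_pmf.prob q F\<bar> \<le> B" if "finite F" for F
  proof -
    let ?g = "\<lambda>s. \<Sum>j\<in>F. (-1)^(s - j) * real (s choose j) * (S s - L s)"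
    have g: "?g sums (\<Sum>j\<in>F. pmf p j - pmf q j)"
      using sums_diff[OF S L] by (intro sums_sum) (simp add: algebra_simps)
    have g_le: "\<bar>?g s\<bar> \<le> 2 ^ s * D s" for s
    proof -
      have "\<bar>?g s\<bar> \<le> (\<Sum>j\<in>F. real (s choose j) * \<bar>S s - L s\<bar>)"
        by (rule order_trans[OF sum_abs]) (simp add: abs_mult)
      also have "\<dots> = (\<Sum>j\<in>F. real (s choose j)) * \<bar>S s - L s\<bar>"
        by (simp add: sum_distrib_right)
      also have "\<dots> \<le> 2 ^ s * D s"
        using row[OF that] D by (intro mult_mono) auto
      finally show ?thesis .
    qed
    have abs_summ: "summable (\<lambda>s. \<bar>?g s\<bar>)"
      by (rule summable_comparison_test'[OF sums_summable[OF summ]]) (use g_le in auto)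
    have "\<bar>\<Sum>j\<in>F. pmf p j - pmf q j\<bar> \<le> (\<Sum>s. \<bar>?g s\<bar>)"
      using summable_rabs[OF abs_summ] g by (simp add: sums_iff)
    also have "\<dots> \<le> B"
      using suminf_le[OF g_le abs_summ sums_summable[OF summ]] summ by (simp add: sums_iff)
    finally show ?thesis
      using that by (simp add: measure_measure_pmf_finite sum_subtractf)
  qed
  \<comment> \<open>An arbitrary event is the increasing union of its finite truncations, and the
    bound passes to the limit.\<close>
  have lim: "(\<lambda>N. measure_pmf.prob r (A \<inter> {..N})) \<longlonglongrightarrow> measure_pmf.prob r A" for r :: "nat pmf"
  proof -
    have "(\<lambda>N. measure_pmf.prob r (A \<inter> {..N})) \<longlonglongrightarrow> measure_pmf.prob r (\<Union>N. A \<inter> {..N})"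
      by (intro measure_pmf.finite_Lim_measure_incseq) (auto simp: incseq_def)
    also have "(\<Union>N. A \<inter> {..N}) = A" by auto
    finally show ?thesis .
  qed
  have "(\<lambda>N. \<bar>measure_pmf.prob p (A \<inter> {..N}) - measure_pmf.prob q (A \<inter> {..N})\<bar>)
      \<longlonglongrightarrow> \<bar>measure_pmf.prob p A - measure_pmf.prob q A\<bar>"
    by (intro tendsto_intros lim)
  then show "\<bar>measure_pmf.prob p A - measure_pmf.prob q A\<bar> \<le> B"
    by (rule LIMSEQ_le_const2) (auto intro!: fin)
qed

section \<open>Relative error of the binomial moments\<close>

lemma one_minus_sum_le_prod:
  fixes a :: "'a \<Rightarrow> real"
  assumes "finite I" and "\<And>i. i \<in> I \<Longrightarrow> 0 \<le> a i" "\<And>i. i \<in> I \<Longrightarrow> a i \<le> 1"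
  shows "1 - (\<Sum>i\<in>I. a i) \<le> (\<Prod>i\<in>I. 1 - a i)"
  using assms
proof (induction I rule: finite_induct)
  case (insert i I)
  have "a i * (\<Prod>i\<in>I. 1 - a i) \<le> a i * 1"
    using insert.prems by (intro mult_left_mono prod_le_1) auto
  moreover have "1 - (\<Sum>i\<in>I. a i) \<le> (\<Prod>i\<in>I. 1 - a i)"
    using insert by auto
  ultimately show ?case
    using insert.hyps by (simp add: left_diff_distrib)
qed auto

text \<open>The ratio is the product of \<open>1 - i / n\<close> over \<open>i < s\<close>; each of
  the \<open>s\<close> subtracted terms is at most \<open>s / n\<close>.\<close>

lemma falling_factorial_ratio_bounds:
  assumes "s \<le> n" "n > 0"
  shows "1 - real s ^ 2 / n \<le> real (n choose s) * fact s / real n ^ s"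
    and "real (n choose s) * fact s / real n ^ s \<le> 1"
proof -
  have eq: "real (n choose s) * fact s / real n ^ s = (\<Prod>i<s. 1 - i / n)"
  proof -
    have "real (n choose s) * fact s = (\<Prod>i<s. real n - i)"
      by (simp add: binomial_gbinomial gbinomial_prod_rev atLeast0LessThan)
    then have "real (n choose s) * fact s / real n ^ s = (\<Prod>i<s. (real n - i) / n)"
      by (simp add: prod_dividef)
    also have "\<dots> = (\<Prod>i<s. 1 - i / n)"
      using assms by (simp add: diff_divide_distrib)
    finally show ?thesis .
  qed
  have "1 - (\<Sum>i<s. i / n) \<le> (\<Prod>i<s. 1 - i / n)"
    using assms by (intro one_minus_sum_le_prod) auto
  moreover have "(\<Sum>i<s. i / n) \<le> (\<Sum>i<s. s / n)"
    by (intro sum_mono divide_right_mono) auto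
  ultimately show "1 - real s ^ 2 / n \<le> real (n choose s) * fact s / real n ^ s"
    unfolding eq by (simp add: power2_eq_square)
  show "real (n choose s) * fact s / real n ^ s \<le> 1"
    unfolding eq using assms by (intro prod_le_1) auto
qed

text \<open>The inequality \<open>1 + y \<le> exp y\<close> at \<open>y = x\<close> and
  \<open>y = - x\<close> puts \<open>(1 - x) * exp x\<close> between \<open>1 - x\<^sup>2\<close>
  and \<open>1\<close>; Bernoulli's inequality handles the \<open>k\<close>-th power.\<close>

lemma power_one_minus_ge:
  fixes x :: real
  assumes "0 \<le> x" "x \<le> 1"
  shows "1 - k * x\<^sup>2 \<le> (1 - x) ^ k * exp (k * x)" and "(1 - x) ^ k * exp (k * x) \<le> 1"
proof -
  have eq: "(1 - x) ^ k * exp (k * x) = ((1 - x) * exp x) ^ k"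
    by (simp add: exp_of_nat_mult power_mult_distrib)
  have "x\<^sup>2 \<le> 1"
    using assms by (simp add: power_le_one)
  have "1 - x\<^sup>2 = (1 - x) * (1 + x)"
    by (simp add: algebra_simps power2_eq_square)
  also have "\<dots> \<le> (1 - x) * exp x"
    using assms by (intro mult_left_mono) auto
  finally have "(1 - x\<^sup>2) ^ k \<le> ((1 - x) * exp x) ^ k"
    using \<open>x\<^sup>2 \<le> 1\<close> by (intro power_mono) auto
  moreover have "1 + real k * (- x\<^sup>2) \<le> (1 + (- x\<^sup>2)) ^ k"
    using \<open>x\<^sup>2 \<le> 1\<close> by (intro Bernoulli_inequality) auto
  ultimately show "1 - k * x\<^sup>2 \<le> (1 - x) ^ k * exp (k * x)"
    unfolding eq by simp
  have "(1 - x) * exp x \<le> exp (- x) * exp x"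
    using exp_ge_add_one_self[of "- x"] by (intro mult_right_mono) auto
  then have "(1 - x) * exp x \<le> 1"
    by (simp add: exp_minus)
  then show "(1 - x) ^ k * exp (k * x) \<le> 1"
    unfolding eq using assms by (intro power_le_one) auto
qed

lemma binomial_moment_diff_le:
  fixes l :: real
  assumes "n > 0" and l: "l = n * exp (- (k / n))"
  shows "\<bar>real (n choose s) * (1 - s / n) ^ k - l ^ s / fact s\<bar>
    \<le> l ^ s / fact s * (real s ^ 2 * (1 / n + k / real n ^ 2))"
proof -
  have "0 \<le> l"
    by (simp add: l)
  show ?thesis
  proof (cases "s \<le> n")
    case True
    \<comment> \<open>\<open>P * Q\<close> is the ratio of the two moments: \<open>P\<close>
      compares \<open>n choose s\<close> with \<open>n ^ s / fact s\<close>, and \<open>Q\<close>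
      compares \<open>(1 - s / n) ^ k\<close> with its exponential approximation.\<close>
    define P where "P = real (n choose s) * fact s / real n ^ s"
    define Q where "Q = (1 - s / n) ^ k * exp (k * (s / n))"
    have P: "1 - real s ^ 2 / n \<le> P" "P \<le> 1"
      using falling_factorial_ratio_bounds[OF True assms(1)] by (auto simp: P_def)
    have Q: "1 - k * (s / n)\<^sup>2 \<le> Q" "Q \<le> 1"
      unfolding Q_def using True assms(1) power_one_minus_ge[of "s / n" k] by auto
    have "0 \<le> P" "0 \<le> Q"
      unfolding P_def Q_def using True assms(1) by (auto intro!: mult_nonneg_nonneg)
    have ls: "l ^ s = real n ^ s * exp (- (k * (s / n)))"
      by (simp add: l power_mult_distrib flip: exp_of_nat_mult)
    have "real (n choose s) * (1 - s / n) ^ k = l ^ s / fact s * (P * Q)"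
      using assms(1) unfolding ls P_def Q_def by (simp add: exp_minus)
    then have "\<bar>real (n choose s) * (1 - s / n) ^ k - l ^ s / fact s\<bar> = \<bar>l ^ s / fact s * (P * Q - 1)\<bar>"
      by (simp only: right_diff_distrib mult_1_right)
    also have "\<dots> = l ^ s / fact s * \<bar>P * Q - 1\<bar>"
      using \<open>0 \<le> l\<close> by (simp add: abs_mult)
    also have "\<dots> \<le> l ^ s / fact s * (real s ^ 2 * (1 / n + k / real n ^ 2))"
    proof (rule mult_left_mono)
      have "\<bar>P * Q - 1\<bar> = 1 - P * Q"
        using mult_le_one[OF P(2) \<open>0 \<le> Q\<close> Q(2)] by simp
      also have "\<dots> \<le> (1 - P) + (1 - Q)"
        using mult_nonneg_nonneg[of "1 - P" "1 - Q"] P Q by (simp add: algebra_simps)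
      also have "\<dots> \<le> real s ^ 2 / n + k * (s / n)\<^sup>2"
        using P Q by linarith
      also have "\<dots> = real s ^ 2 * (1 / n + k / real n ^ 2)"
        by (simp add: distrib_left power_divide)
      finally show "\<bar>P * Q - 1\<bar> \<le> real s ^ 2 * (1 / n + k / real n ^ 2)" .
    qed (use \<open>0 \<le> l\<close> in simp)
    finally show ?thesis .
  next
    case False
    \<comment> \<open>For \<open>s > n\<close> the empty-box moment is zero, so the relative error
      is exactly 1, and \<open>s\<^sup>2 / n\<close> already exceeds that.\<close>
    have "1 \<le> real s * (real s / n)"
      using False assms(1) mult_mono[of 1 "real s" 1 "s / n"] by simp
    also have "\<dots> \<le> real s ^ 2 * (1 / n + k / real n ^ 2)"
      by (simp add: power2_eq_square distrib_left)
    finally have "l ^ s / fact s * 1 \<le> l ^ s / fact s * (real s ^ 2 * (1 / n + k / real n ^ 2))"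
      using \<open>0 \<le> l\<close> by (intro mult_left_mono) auto
    then show ?thesis
      using False \<open>0 \<le> l\<close> by (simp add: binomial_eq_0)
  qed
qed

section \<open>Explicit bound and choice of the constant\<close>

lemma tv_dist_empty_boxes_poisson_le:
  fixes l :: real
  assumes "n > 0" and l: "l = n * exp (- (k / n))"
  shows "tv_dist (measure_pmf (empty_boxes_law k n)) (measure_pmf (poisson_pmf l))
    \<le> 4 * l * exp (4 * l) * (1 / n + k / real n ^ 2)"
proof (rule tv_dist_le_binomial_moments)
  let ?\<epsilon> = "1 / n + k / real n ^ 2"
  have "l > 0"
    using assms by simp
  show "(\<lambda>s. (-1)^(s - j) * real (s choose j) * (real (n choose s) * (1 - s / n) ^ k))
      sums pmf (empty_boxes_law k n) j" for j
    by (rule pmf_empty_boxes_law_sums) fact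
  show "(\<lambda>s. (-1)^(s - j) * real (s choose j) * (l ^ s / fact s)) sums pmf (poisson_pmf l) j" for j
    by (rule pmf_poisson_sums) fact
  show "\<bar>real (n choose s) * (1 - s / n) ^ k - l ^ s / fact s\<bar> \<le> s * (2 * l) ^ s / fact s * ?\<epsilon>" for s
  proof -
    \<comment> \<open>Giving up a factor \<open>2 ^ s\<close> turns \<open>s\<^sup>2\<close> into
      \<open>s\<close>, which cancels against the factorial. With the \<open>2 ^ s\<close> from the
      row sums this makes \<open>4 * l\<close> the argument of the exponential.\<close>
    have "real s ^ 2 \<le> real s * 2 ^ s"
      unfolding power2_eq_square using of_nat_less_two_power[of s, where 'a = real]
      by (intro mult_left_mono) auto
    then have "l ^ s / fact s * (real s ^ 2 * ?\<epsilon>) \<le> l ^ s / fact s * (real s * 2 ^ s * ?\<epsilon>)"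
      using \<open>l > 0\<close> by (intro mult_left_mono mult_right_mono) auto
    also have "\<dots> = s * (2 * l) ^ s / fact s * ?\<epsilon>"
      by (simp add: power_mult_distrib)
    finally show ?thesis
      using binomial_moment_diff_le[OF assms] by (rule order_trans[rotated])
  qed
  have "(\<lambda>s. (4 * l) * ((4 * l) ^ s / fact s)) sums (4 * l * exp (4 * l))"
    using exp_converges[of "4 * l"] by (intro sums_mult) (simp add: divide_inverse mult_ac)
  also have "(\<lambda>s. (4 * l) * ((4 * l) ^ s / fact s))
      = (\<lambda>s. real (Suc s) * (4 * l) ^ Suc s / fact (Suc s))"
    by (simp add: fun_eq_iff del: of_nat_Suc)
  finally have "(\<lambda>s. s * (4 * l) ^ s / fact s) sums (4 * l * exp (4 * l))"
    using sums_Suc[of "\<lambda>s. s * (4 * l) ^ s / fact s"] by force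
  then have "(\<lambda>s. s * (4 * l) ^ s / fact s * ?\<epsilon>) sums (4 * l * exp (4 * l) * ?\<epsilon>)"
    by (rule sums_mult2)
  moreover have "s * (4 * l) ^ s / fact s * ?\<epsilon> = 2 ^ s * (s * (2 * l) ^ s / fact s * ?\<epsilon>)" for s
  proof -
    have *: "(4 * l) ^ s = 2 ^ s * (2 * l) ^ s"
      using power_mult_distrib[of 2 "2 * l" s] by simp
    show ?thesis
      unfolding * by simp
  qed
  ultimately show "(\<lambda>s. 2 ^ s * (s * (2 * l) ^ s / fact s * ?\<epsilon>)) sums (4 * l * exp (4 * l) * ?\<epsilon>)"
    by (simp only:)
qed

text \<open>To be applied with \<open>x = sqrt (ln n)\<close>, where \<open>exp (x\<^sup>2)\<close>
  is \<open>n\<close>. The left side is at most \<open>exp (7 * x)\<close>, with 7 = 1 + 2 + 4 from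
  the three factors.\<close>

lemma exp_4_sqrt_ln_negligible:
  fixes x :: real
  assumes "x \<ge> 0"
  shows "x * (1 + x\<^sup>2) * exp (4 * x) \<le> exp 13 * exp (x\<^sup>2)"
proof -
  have "x \<le> exp x"
    using exp_ge_add_one_self[of x] by linarith
  moreover have "1 + x\<^sup>2 \<le> exp x * exp x"
  proof -
    have "1 + x\<^sup>2 \<le> (1 + x) * (1 + x)"
      using assms by (simp add: power2_eq_square algebra_simps)
    also have "\<dots> \<le> exp x * exp x"
      using assms by (intro mult_mono) auto
    finally show ?thesis .
  qed
  ultimately have "x * (1 + x\<^sup>2) * exp (4 * x) \<le> exp x * (exp x * exp x) * exp (4 * x)"
    using assms by (intro mult_mono) auto
  also have "\<dots> = exp (7 * x)"
    by (simp flip: exp_add)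
  \<comment> \<open>Completing the square needs the constant 49/4, rounded up to 13.\<close>
  also have "\<dots> \<le> exp (13 + x\<^sup>2)"
  proof -
    have "0 \<le> (x - 7 / 2)\<^sup>2" by simp
    also have "(x - 7 / 2)\<^sup>2 = x\<^sup>2 - 7 * x + 49 / 4"
      by (simp add: power2_eq_square algebra_simps)
    finally show ?thesis by simp
  qed
  finally show ?thesis
    by (simp add: exp_add)
qed

text \<open>The upper bound on \<open>\<theta>\<close> keeps \<open>k / n\<^sup>2\<close> of order
  \<open>1 / sqrt (ln n)\<close>, with \<open>C\<close> depending on \<open>A\<close> only. Some
  restriction is unavoidable: for fixed \<open>n\<close> and \<open>\<theta>\<close> tending to
  infinity, the probability of an empty box is \<open>o(exp (- \<theta>))\<close>, so the distance
  is at least \<open>(1 - o(1)) * exp (- \<theta>)\<close>.\<close>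

theorem theorem9:
  shows "\<forall>A::real. \<exists>C::real. \<forall>(n::nat) (k::nat) (\<theta>::real).
    n \<ge> 2 \<longrightarrow>
    real k = real n * ln (real n) + \<theta> * real n \<longrightarrow>
    \<theta> \<le> A * real n / sqrt (ln (real n)) \<longrightarrow>
    tv_dist (measure_pmf (empty_boxes_law k n)) (measure_pmf (poisson_pmf (exp (- \<theta>))))
      \<le> C * (exp (- \<theta>) / sqrt (ln (real n)))"
proof (intro allI exI impI)
  fix A :: real and n k :: nat and \<theta> :: real
  \<comment> \<open>The first summand absorbs the contribution of \<open>1 + x\<^sup>2\<close>, the
    second that of \<open>\<theta>\<close>; the last ensures \<open>C \<ge> 1\<close> for the
    trivial case \<open>l > x\<close>.\<close>
  define C where "C = 4 * exp 13 + 4 * exp 4 * \<bar>A\<bar> + 1"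
  assume n: "n \<ge> 2" and k: "real k = real n * ln (real n) + \<theta> * real n"
    and \<theta>: "\<theta> \<le> A * real n / sqrt (ln (real n))"
  define l where "l = exp (- \<theta>)"
  define x where "x = sqrt (ln (real n))"
  have x: "x > 0" "x\<^sup>2 = ln (real n)" "exp (x\<^sup>2) = real n"
    using n by (auto simp: x_def)
  have "l > 0"
    by (simp add: l_def)
  have "C \<ge> 1"
    by (simp add: C_def)
  have "tv_dist (measure_pmf (empty_boxes_law k n)) (measure_pmf (poisson_pmf l)) \<le> C * (l / x)"
  proof (cases "l \<le> x")
    case False
    then have "1 * 1 \<le> C * (l / x)"
      using x \<open>C \<ge> 1\<close> by (intro mult_mono) auto
    then show ?thesis
      by (simp add: order_trans[OF tv_dist_pmf_le_1])
  next
    case True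
    have kn: "real k / n = x\<^sup>2 + \<theta>"
      using n k by (simp add: x field_simps)
    have "l = n * exp (- (k / n))"
      unfolding kn using n x(3) by (simp add: l_def exp_diff exp_minus field_simps)
    then have tv: "tv_dist (measure_pmf (empty_boxes_law k n)) (measure_pmf (poisson_pmf l))
        \<le> 4 * l * exp (4 * l) * (1 / n + k / real n ^ 2)"
      using n by (intro tv_dist_empty_boxes_poisson_le) auto
    have "real k / real n ^ 2 = real k / n / n"
      by (simp add: power2_eq_square)
    then have eps: "1 / n + k / real n ^ 2 = (1 + x\<^sup>2 + \<theta>) / n"
      unfolding kn by (simp add: add_divide_distrib)
    have main: "x * (1 + x\<^sup>2) * exp (4 * l) \<le> exp 13 * n"
    proof -
      have "x * (1 + x\<^sup>2) * exp (4 * l) \<le> x * (1 + x\<^sup>2) * exp (4 * x)"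
        using True x by (intro mult_left_mono) auto
      also have "\<dots> \<le> exp 13 * n"
        using exp_4_sqrt_ln_negligible[of x] x(1) unfolding x(3) by simp
      finally show ?thesis .
    qed
    have rest: "x * \<theta> * exp (4 * l) \<le> exp 4 * \<bar>A\<bar> * n"
    \<comment> \<open>For \<open>\<theta> \<ge> 0\<close> one has \<open>l \<le> 1\<close>, hence
      \<open>exp (4 * l) \<le> exp 4\<close>, which leaves the whole factor \<open>n\<close> to the
      bound on \<open>\<theta>\<close>. A negative \<open>\<theta>\<close> only helps.\<close>
    proof (cases "\<theta> \<ge> 0")
      case True
      have "x * \<theta> \<le> A * n"
        using \<theta> x(1) by (simp add: field_simps flip: x_def)
      also have "\<dots> \<le> \<bar>A\<bar> * n"
        by (intro mult_right_mono) auto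
      finally have "x * \<theta> * exp (4 * l) \<le> \<bar>A\<bar> * n * exp 4"
        using True x(1) by (intro mult_mono[of "x * \<theta>"]) (auto simp: l_def)
      then show ?thesis by (simp add: mult_ac)
    next
      case False
      then have "x * \<theta> * exp (4 * l) \<le> 0"
        using x(1) by (simp add: mult_nonneg_nonpos mult_nonpos_nonneg)
      also have "0 \<le> exp 4 * \<bar>A\<bar> * n" by simp
      finally show ?thesis .
    qed
    have "4 * (x * (1 + x\<^sup>2) * exp (4 * l) + x * \<theta> * exp (4 * l)) \<le> (C - 1) * n"
      using main rest by (simp add: C_def algebra_simps)
    then have "4 * exp (4 * l) * (1 + x\<^sup>2 + \<theta>) * x \<le> (C - 1) * n"
      by (simp add: algebra_simps)
    also have "\<dots> \<le> C * n"
      by (simp add: algebra_simps)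
    finally have "4 * exp (4 * l) * ((1 + x\<^sup>2 + \<theta>) / n) \<le> C / x"
      using x(1) n by (simp add: field_simps)
    then have "l * (4 * exp (4 * l) * ((1 + x\<^sup>2 + \<theta>) / n)) \<le> l * (C / x)"
      using \<open>l > 0\<close> by (intro mult_left_mono) auto
    then show ?thesis
      using tv unfolding eps by (simp add: mult_ac)
  qed
  then show "tv_dist (measure_pmf (empty_boxes_law k n)) (measure_pmf (poisson_pmf (exp (- \<theta>))))
      \<le> (4 * exp 13 + 4 * exp 4 * \<bar>A\<bar> + 1) * (exp (- \<theta>) / sqrt (ln (real n)))"
    by (simp add: l_def x_def C_def)
qed

end
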